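(* (Simplex Lemma I) Let $P$ be a finite set of points in $\mathbb{R}^d$ with a partition $P=\bigcup_{l=1}^j P_l$ into nonempty sets, $P_{l_1}\cap P_{l_2}=\emptyset$ for any $l_1\ne l_2$. Let $o$ be the mean point of $P$, and $o_l$ be the mean point of $P_l$ for $1\le l\le j$. Further let $\delta^2=\frac{1}{|P|}\sum_{p\in P}\|p-o\|^2$, and let $V$ be the simplex determined by $\{o_1,\dots,o_j\}$. Then for any $0<\epsilon\le 1$, it is possible to construct (from $o_1,\dots,o_j$ and $\epsilon$ only, without knowledge of $P$ and its partition) a grid of size $O((8j/\epsilon)^j)$ inside $V$ such that at least one grid point $\tau$ satisfies $\|\tau-o\|\le\sqrt{\epsilon}\,\delta$.
   Context: The mean point of a finite nonempty set $Q\subset\mathbb{R}^d$ is $\frac{1}{|Q|}\sum_{q\in Q}q$. The simplex determined by $\{o_1,\dots,o_j\}$ is their convex hull (possibly degenerate). A grid of size $N$ means a finite set of $N$ points. The set $P$ is regarded as unknown; the only known information is the points $o_1,\dots,o_j$. Equivalently, one grid built from $(o_1,\dots,o_j,\epsilon)$ must work for all $P$ and partitions having these mean points. *)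

theory Defs
  imports "HOL-Analysis.Analysis" "HOL-Analysis.Finite_Function_Topology"
begin

text \<open>
  The constant hidden in the O-bound of the theorem must not depend on the dimension \<open>d\<close>, so \<open>d\<close> has
  to be quantified inside the statement. Therefore \<open>\<real>\<^sup>d\<close> is not a type here but the subspace
  \<open>Rd d\<close> of the real vector space of finitely supported real sequences, with the library's vector
  operations and convex hull. Coordinates are numbered from 0.
\<close>

type_synonym point = "(nat, real) poly_mapping"

definition Rd :: "nat \<Rightarrow> point set" where
  "Rd d = {x. Poly_Mapping.keys x \<subseteq> {..<d}}"

text \<open>
  The class instance \<^const>\<open>norm\<close> on this type is the sum of the absolute values of the coordinates
  and not the Euclidean norm, so it must not be used here. Coordinates outside the keys are zero.
\<close>

definition euclid_norm :: "point \<Rightarrow> real" where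
  "euclid_norm x = L2_set (Poly_Mapping.lookup x) (Poly_Mapping.keys x)"

definition mean_point :: "point set \<Rightarrow> point" where
  "mean_point Q = (1 / real (card Q)) *\<^sub>R (\<Sum>q\<in>Q. q)"

end

theory Submission
  imports Defs
begin

text \<open>
  The mean \<open>o\<close> is the convex combination of the \<open>o\<^sub>l\<close> with weights \<open>\<bar>P\<^sub>l\<bar> / \<bar>P\<bar>\<close>, and the weighted
  variance of the \<open>o\<^sub>l\<close> around \<open>o\<close> is at most \<open>\<delta>\<^sup>2\<close>. By Maurey's empirical method, the average of
  \<open>m\<close> independent samples of the \<open>o\<^sub>l\<close> with these weights has expected squared distance at most
  \<open>\<delta>\<^sup>2 / m\<close> from \<open>o\<close>. With \<open>m = \<lceil>1/\<epsilon>\<rceil>\<close> the grid consists of all convex combinations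
  whose weights are multiples of \<open>1/m\<close>; there are at most \<open>(m + 1) ^ j \<le> (3/\<epsilon>) ^ j\<close> of them.
\<close>

section \<open>Weighted averages and derandomized sampling\<close>

text \<open>This replaces the expectation argument of random sampling: if all values exceeded
  \<open>B\<close>, then the nonnegative terms \<open>\<alpha> l * (f l - B)\<close> would have a
  sum of at most 0, so every weight would vanish.\<close>

lemma exists_le_weighted_average:
  fixes \<alpha> f :: "'b \<Rightarrow> real"
  assumes "\<And>l. l \<in> J \<Longrightarrow> 0 \<le> \<alpha> l" "sum \<alpha> J = 1" "(\<Sum>l\<in>J. \<alpha> l * f l) \<le> B"
  shows "\<exists>l\<in>J. f l \<le> B"
proof (rule ccontr)
  assume "\<not> ?thesis"
  then have gt: "B < f l" if "l \<in> J" for l using that by force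
  \<comment> \<open>A sum over an infinite set is 0 by convention, so a total of 1 forces
    finiteness.\<close>
  have fin: "finite J" using assms(2) by (metis sum.infinite zero_neq_one)
  have nn: "0 \<le> \<alpha> l * (f l - B)" if "l \<in> J" for l
    using assms(1)[OF that] gt[OF that] by simp
  have "(\<Sum>l\<in>J. \<alpha> l * (f l - B)) = (\<Sum>l\<in>J. \<alpha> l * f l) - B"
    by (simp add: algebra_simps sum_subtractf assms(2) flip: sum_distrib_left)
  moreover have "0 \<le> (\<Sum>l\<in>J. \<alpha> l * (f l - B))" by (intro sum_nonneg nn)
  ultimately have "(\<Sum>l\<in>J. \<alpha> l * (f l - B)) = 0" using assms(3) by linarith
  then have "\<forall>l\<in>J. \<alpha> l * (f l - B) = 0"
    using sum_nonneg_eq_0_iff[OF fin nn] by simp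
  then have "\<forall>l\<in>J. \<alpha> l = 0" using gt by force
  with assms(2) show False by simp
qed

text \<open>The cross term vanishes because \<open>c\<close> is the weighted mean of the
  \<open>x l\<close>. Here \<open>D\<close> plays the error accumulated so far in one coordinate,
  and \<open>x l - c\<close> the contribution of the next sample.\<close>

lemma sum_weighted_shift_square:
  fixes \<alpha> x :: "'b \<Rightarrow> real"
  assumes "sum \<alpha> J = 1" "(\<Sum>l\<in>J. \<alpha> l * x l) = c"
  shows "(\<Sum>l\<in>J. \<alpha> l * (D + (x l - c))\<^sup>2) = D\<^sup>2 + (\<Sum>l\<in>J. \<alpha> l * (x l - c)\<^sup>2)"
proof -
  have "(\<Sum>l\<in>J. \<alpha> l * (D + (x l - c))\<^sup>2)
      = (\<Sum>l\<in>J. D\<^sup>2 * \<alpha> l + 2 * D * (\<alpha> l * x l) - 2 * D * c * \<alpha> l + \<alpha> l * (x l - c)\<^sup>2)"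
    by (rule sum.cong) (auto simp: power2_eq_square algebra_simps)
  also have "\<dots> = D\<^sup>2 + (\<Sum>l\<in>J. \<alpha> l * (x l - c)\<^sup>2)"
    by (simp add: sum.distrib sum_subtractf assms flip: sum_distrib_left)
  finally show ?thesis .
qed

text \<open>
  The derandomized form of Maurey's method: the samples are chosen one after the other, each time
  not exceeding the average.
\<close>
lemma maurey_multiplicities:
  fixes \<alpha> :: "'b \<Rightarrow> real" and x :: "'b \<Rightarrow> 'i \<Rightarrow> real"
  assumes nonneg: "\<And>l. l \<in> J \<Longrightarrow> 0 \<le> \<alpha> l" and one: "sum \<alpha> J = 1"
    and mean: "\<And>i. i \<in> I \<Longrightarrow> (\<Sum>l\<in>J. \<alpha> l * x l i) = c i"
  shows "\<exists>k::'b \<Rightarrow> nat. sum k J = m \<and>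
    (\<Sum>i\<in>I. ((\<Sum>l\<in>J. real (k l) * x l i) - real m * c i)\<^sup>2)
      \<le> real m * (\<Sum>l\<in>J. \<alpha> l * (\<Sum>i\<in>I. (x l i - c i)\<^sup>2))"
proof (induction m)
  case 0
  show ?case by (intro exI[of _ "\<lambda>_. 0"]) simp
next
  case (Suc m)
  let ?V = "\<Sum>l\<in>J. \<alpha> l * (\<Sum>i\<in>I. (x l i - c i)\<^sup>2)"
  have fin: "finite J" using one by (metis sum.infinite zero_neq_one)
  obtain k :: "'b \<Rightarrow> nat" where k: "sum k J = m"
    "(\<Sum>i\<in>I. ((\<Sum>l\<in>J. real (k l) * x l i) - real m * c i)\<^sup>2) \<le> real m * ?V"
    using Suc.IH by blast
  \<comment> \<open>The error is kept unnormalized, as \<open>m\<close> times the error of the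
    average, so that a new sample simply adds \<open>x l i - c i\<close>.\<close>
  define D where "D i = (\<Sum>l\<in>J. real (k l) * x l i) - real m * c i" for i
  have "(\<Sum>l\<in>J. \<alpha> l * (\<Sum>i\<in>I. (D i + (x l i - c i))\<^sup>2))
      = (\<Sum>i\<in>I. \<Sum>l\<in>J. \<alpha> l * (D i + (x l i - c i))\<^sup>2)"
    by (simp add: sum_distrib_left) (rule sum.swap)
  also have "\<dots> = (\<Sum>i\<in>I. (D i)\<^sup>2 + (\<Sum>l\<in>J. \<alpha> l * (x l i - c i)\<^sup>2))"
    by (intro sum.cong refl sum_weighted_shift_square one mean)
  also have "\<dots> = (\<Sum>i\<in>I. (D i)\<^sup>2) + ?V"
    by (simp add: sum.distrib sum_distrib_left) (rule sum.swap)
  also have "\<dots> \<le> real (Suc m) * ?V"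
    using k(2) by (simp add: D_def algebra_simps)
  finally have "(\<Sum>l\<in>J. \<alpha> l * (\<Sum>i\<in>I. (D i + (x l i - c i))\<^sup>2)) \<le> real (Suc m) * ?V" .
  from exists_le_weighted_average[OF nonneg one this]
  obtain a where a: "a \<in> J" "(\<Sum>i\<in>I. (D i + (x a i - c i))\<^sup>2) \<le> real (Suc m) * ?V"
    by blast
  \<comment> \<open>The sample \<open>a\<close> is drawn once more.\<close>
  define k' where "k' l = k l + (if l = a then 1 else 0)" for l
  have "sum k' J = Suc m"
    using a(1) fin k(1) by (simp add: k'_def sum.distrib)
  moreover have "(\<Sum>l\<in>J. real (k' l) * x l i) - real (Suc m) * c i = D i + (x a i - c i)" for i
  proof -
    have "(\<Sum>l\<in>J. real (k' l) * x l i)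
        = (\<Sum>l\<in>J. real (k l) * x l i + (if l = a then x l i else 0))"
      by (rule sum.cong) (auto simp: k'_def algebra_simps)
    also have "\<dots> = (\<Sum>l\<in>J. real (k l) * x l i) + x a i"
      using a(1) fin by (simp add: sum.distrib)
    finally show ?thesis by (simp add: D_def algebra_simps)
  qed
  ultimately show ?case using a(2) by (intro exI[of _ k']) simp
qed

section \<open>Means and norms in coordinates\<close>

text \<open>By the parallel axis identity, the two sides differ by the sum of squared deviations
  from \<mu>, which is nonnegative.\<close>

lemma card_mult_square_mean_le:
  fixes f :: "'a \<Rightarrow> real"
  assumes "card Q \<noteq> 0" and \<mu>: "\<mu> = (1 / real (card Q)) * sum f Q"
  shows "real (card Q) * (\<mu> - c)\<^sup>2 \<le> (\<Sum>q\<in>Q. (f q - c)\<^sup>2)"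
proof -
  have s: "sum f Q = real (card Q) * \<mu>" using assms by simp
  have "(\<Sum>q\<in>Q. (f q - c)\<^sup>2)
      = (\<Sum>q\<in>Q. (f q - \<mu>)\<^sup>2 + 2 * (\<mu> - c) * f q - 2 * (\<mu> - c) * \<mu> + (\<mu> - c)\<^sup>2)"
    by (rule sum.cong) (auto simp: power2_eq_square algebra_simps)
  also have "\<dots> = (\<Sum>q\<in>Q. (f q - \<mu>)\<^sup>2) + real (card Q) * (\<mu> - c)\<^sup>2"
    by (simp add: sum.distrib sum_subtractf s flip: sum_distrib_left)
  finally show ?thesis by (simp add: sum_nonneg)
qed

lemma lookup_scaleR_point: "Poly_Mapping.lookup (r *\<^sub>R (x::point)) i = r * Poly_Mapping.lookup x i"
proof -
  \<comment> \<open>Finite support is what lets \<open>lookup\<close> recover the function that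
    defines the scaled element.\<close>
  have "finite {i. r *\<^sub>R Poly_Mapping.lookup x i \<noteq> 0}"
    by (rule finite_subset[OF _ finite_keys[of x]]) (auto simp: in_keys_iff)
  then show ?thesis by (simp add: scaleR_poly_mapping_def)
qed

lemma lookup_mean_point:
  "Poly_Mapping.lookup (mean_point Q) i = (1 / real (card Q)) * (\<Sum>q\<in>Q. Poly_Mapping.lookup q i)"
  by (simp add: mean_point_def lookup_sum lookup_scaleR_point)

lemma Rd_iff: "x \<in> Rd d \<longleftrightarrow> (\<forall>i\<ge>d. Poly_Mapping.lookup x i = 0)"
  by (auto simp: Rd_def in_keys_iff subset_iff) (metis leI)

text \<open>One index set for all points of \<open>Rd d\<close>, in place of their individual keys,
  makes it possible to exchange sums over points and over coordinates.\<close>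

lemma euclid_norm_square:
  assumes "x \<in> Rd d"
  shows "(euclid_norm x)\<^sup>2 = (\<Sum>i<d. (Poly_Mapping.lookup x i)\<^sup>2)"
proof -
  have "(euclid_norm x)\<^sup>2 = (\<Sum>i\<in>Poly_Mapping.keys x. (Poly_Mapping.lookup x i)\<^sup>2)"
    by (simp add: euclid_norm_def L2_set_def sum_nonneg)
  also have "\<dots> = (\<Sum>i<d. (Poly_Mapping.lookup x i)\<^sup>2)"
    using assms by (intro sum.mono_neutral_left) (auto simp: Rd_def in_keys_iff)
  finally show ?thesis .
qed

section \<open>The grid and its size\<close>

text \<open>These are the ways to draw \<open>m\<close> samples from \<open>j\<close> points,
  regardless of order. Extensionality fixes the values outside \<open>{..<j}\<close>, so the set
  lies in a finite product that is easy to count.\<close>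

definition multiplicities :: "nat \<Rightarrow> nat \<Rightarrow> (nat \<Rightarrow> nat) set" where
  "multiplicities m j = {k \<in> {..<j} \<rightarrow>\<^sub>E {..m}. sum k {..<j} = m}"

definition simplex_grid :: "nat \<Rightarrow> 'a::real_vector list \<Rightarrow> 'a set" where
  "simplex_grid m os = (\<lambda>k. \<Sum>l<length os. (real (k l) / real m) *\<^sub>R (os ! l)) ` multiplicities m (length os)"

lemma finite_multiplicities: "finite (multiplicities m j)"
  by (rule finite_subset[of _ "{..<j} \<rightarrow>\<^sub>E {..m}"]) (auto simp: multiplicities_def intro: finite_PiE)

lemma card_multiplicities_le: "card (multiplicities m j) \<le> (m + 1) ^ j"
proof -
  have "card (multiplicities m j) \<le> card ({..<j} \<rightarrow>\<^sub>E {..m})"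
    by (intro card_mono finite_PiE) (auto simp: multiplicities_def)
  then show ?thesis by (simp add: card_PiE)
qed

lemma simplex_grid_subset_hull:
  assumes "m > 0"
  shows "simplex_grid m os \<subseteq> convex hull (set os)"
proof
  fix y assume "y \<in> simplex_grid m os"
  then obtain k where k: "sum k {..<length os} = m"
    "y = (\<Sum>l<length os. (real (k l) / real m) *\<^sub>R (os ! l))"
    by (auto simp: simplex_grid_def multiplicities_def)
  have "(\<Sum>l<length os. real (k l) / real m) = 1"
    using assms k(1) by (simp flip: sum_divide_distrib of_nat_sum)
  then show "y \<in> convex hull (set os)"
    unfolding k(2) by (intro convex_sum) (auto intro: hull_inc)
qed

section \<open>Approximation of the mean by a grid point\<close>

text \<open>The accumulated squared error of \<open>m\<close> samples is at most \<open>m\<close>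
  times the variance of the \<open>os ! l\<close>; averaging divides it by the square of
  \<open>m\<close>.\<close>

lemma simplex_grid_approximates_mean:
  fixes P :: "point set" and os :: "point list"
  assumes "finite P" "P \<subseteq> Rd d" and P: "P = (\<Union>l<length os. Pl l)"
    and ne: "\<And>l. l < length os \<Longrightarrow> Pl l \<noteq> {}" and disj: "disjoint_family_on Pl {..<length os}"
    and os: "\<And>l. l < length os \<Longrightarrow> os ! l = mean_point (Pl l)"
    and "os \<noteq> []" and m: "m > 0"
  shows "\<exists>\<tau>\<in>simplex_grid m os. (euclid_norm (\<tau> - mean_point P))\<^sup>2
    \<le> ((1 / real (card P)) * (\<Sum>p\<in>P. (euclid_norm (p - mean_point P))\<^sup>2)) / real m"
proof -
  let ?J = "{..<length os}"
  define c where "c = mean_point P"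
  define \<alpha> where "\<alpha> l = real (card (Pl l)) / real (card P)" for l
  define x where "x l = Poly_Mapping.lookup (os ! l)" for l
  have fin: "finite (Pl l)" if "l \<in> ?J" for l
    using that assms(1) P by (auto intro: finite_subset)
  have disj': "\<forall>l\<in>?J. \<forall>l'\<in>?J. l \<noteq> l' \<longrightarrow> Pl l \<inter> Pl l' = {}"
    using disj by (auto simp: disjoint_family_on_def)
  have split: "sum f P = (\<Sum>l\<in>?J. sum f (Pl l))" for f :: "point \<Rightarrow> real"
    unfolding P using fin disj' by (intro sum.UNION_disjoint) auto
  have card_pos: "card (Pl l) \<noteq> 0" if "l \<in> ?J" for l
    using fin[OF that] ne that by simp
  have "P \<noteq> {}" using P ne \<open>os \<noteq> []\<close> by fastforce
  then have cP: "real (card P) > 0" using assms(1) by (simp add: card_gt_0_iff)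
  have x: "x l i = (1 / real (card (Pl l))) * (\<Sum>q\<in>Pl l. Poly_Mapping.lookup q i)"
    if "l \<in> ?J" for l i
    using that by (simp add: x_def os lookup_mean_point)
  \<comment> \<open>For the constant function 1, \<open>split\<close> says that the sizes of the
    parts add up to the size of \<open>P\<close>.\<close>
  have one: "sum \<alpha> ?J = 1"
    using split[of "\<lambda>_. 1"] cP by (simp add: \<alpha>_def flip: sum_divide_distrib)
  have mean: "(\<Sum>l\<in>?J. \<alpha> l * x l i) = Poly_Mapping.lookup c i" for i
  proof -
    have "(\<Sum>l\<in>?J. \<alpha> l * x l i)
        = (\<Sum>l\<in>?J. (\<Sum>q\<in>Pl l. Poly_Mapping.lookup q i) / real (card P))"
      using card_pos by (intro sum.cong refl) (simp add: x \<alpha>_def)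
    then show ?thesis
      by (simp add: c_def lookup_mean_point split flip: sum_divide_distrib)
  qed
  have P0: "Poly_Mapping.lookup p i = 0" if "p \<in> P" "i \<ge> d" for p i
    using that assms(2) by (auto simp: Rd_iff)
  have c0: "Poly_Mapping.lookup c i = 0" if "i \<ge> d" for i
    using P0[OF _ that] by (simp add: c_def lookup_mean_point)
  have x0: "x l i = 0" if "l \<in> ?J" "i \<ge> d" for l i
    unfolding x[OF that(1)] using P0[OF _ that(2)] that(1) P by (auto intro!: sum.neutral)
  \<comment> \<open>Replacing the points of one part by their mean does not increase its share of
    the variance.\<close>
  have "\<alpha> l * (\<Sum>i<d. (x l i - Poly_Mapping.lookup c i)\<^sup>2)
      \<le> (1 / real (card P)) * (\<Sum>p\<in>Pl l. (euclid_norm (p - c))\<^sup>2)" if l: "l \<in> ?J" for l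
  proof -
    have Rd: "p - c \<in> Rd d" if "p \<in> Pl l" for p
      using that l P P0 c0 by (auto simp: Rd_iff lookup_minus)
    have "real (card (Pl l)) * (\<Sum>i<d. (x l i - Poly_Mapping.lookup c i)\<^sup>2)
        \<le> (\<Sum>i<d. \<Sum>p\<in>Pl l. (Poly_Mapping.lookup p i - Poly_Mapping.lookup c i)\<^sup>2)"
      unfolding sum_distrib_left
      by (intro sum_mono card_mult_square_mean_le card_pos l x)
    also have "\<dots> = (\<Sum>p\<in>Pl l. \<Sum>i<d. (Poly_Mapping.lookup p i - Poly_Mapping.lookup c i)\<^sup>2)"
      by (rule sum.swap)
    also have "\<dots> = (\<Sum>p\<in>Pl l. (euclid_norm (p - c))\<^sup>2)"
      using Rd by (intro sum.cong refl) (simp add: euclid_norm_square[where d = d] lookup_minus)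
    finally show ?thesis using cP by (simp add: \<alpha>_def divide_right_mono)
  qed
  then have var: "(\<Sum>l\<in>?J. \<alpha> l * (\<Sum>i<d. (x l i - Poly_Mapping.lookup c i)\<^sup>2))
      \<le> (1 / real (card P)) * (\<Sum>p\<in>P. (euclid_norm (p - c))\<^sup>2)"
    unfolding split sum_distrib_left[of "1 / real (card P)"] by (intro sum_mono)
  have "0 \<le> \<alpha> l" for l by (simp add: \<alpha>_def)
  from maurey_multiplicities[of ?J \<alpha> "{..<d}" x "Poly_Mapping.lookup c" m, OF this one mean]
  obtain k :: "nat \<Rightarrow> nat" where k: "sum k ?J = m"
    "(\<Sum>i<d. ((\<Sum>l\<in>?J. real (k l) * x l i) - real m * Poly_Mapping.lookup c i)\<^sup>2)
      \<le> real m * (\<Sum>l\<in>?J. \<alpha> l * (\<Sum>i<d. (x l i - Poly_Mapping.lookup c i)\<^sup>2))"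
    by blast
  define \<tau> where "\<tau> = (\<Sum>l<length os. (real (k l) / real m) *\<^sub>R (os ! l))"
  \<comment> \<open>The function \<open>k\<close> is arbitrary outside \<open>?J\<close>, whereas
    the grid is indexed by extensional functions; each value on \<open>?J\<close> is at most the
    total \<open>m\<close>.\<close>
  have "restrict k ?J \<in> multiplicities m (length os)"
    using k(1) by (auto simp: multiplicities_def intro!: member_le_sum[of _ ?J k])
  then have \<tau>: "\<tau> \<in> simplex_grid m os"
    by (auto simp: simplex_grid_def \<tau>_def intro!: image_eqI[of _ _ "restrict k ?J"])
  have \<tau>_lookup: "Poly_Mapping.lookup \<tau> i = (\<Sum>l\<in>?J. real (k l) * x l i) / real m" for i
    by (simp add: \<tau>_def x_def lookup_sum lookup_scaleR_point sum_divide_distrib)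
  have "\<tau> - c \<in> Rd d"
    using x0 c0 by (auto simp: Rd_iff lookup_minus \<tau>_lookup)
  then have "(euclid_norm (\<tau> - c))\<^sup>2
      = (\<Sum>i<d. ((\<Sum>l\<in>?J. real (k l) * x l i) / real m - Poly_Mapping.lookup c i)\<^sup>2)"
    by (simp add: euclid_norm_square[where d = d] lookup_minus \<tau>_lookup)
  also have "\<dots> = (\<Sum>i<d. ((\<Sum>l\<in>?J. real (k l) * x l i) - real m * Poly_Mapping.lookup c i)\<^sup>2) / (real m)\<^sup>2"
    using m unfolding sum_divide_distrib[where A = "{..<d}"]
    by (intro sum.cong refl) (simp add: diff_divide_distrib flip: power_divide)
  also have "\<dots> \<le> (real m * (\<Sum>l\<in>?J. \<alpha> l * (\<Sum>i<d. (x l i - Poly_Mapping.lookup c i)\<^sup>2))) / (real m)\<^sup>2"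
    by (intro divide_right_mono k) simp
  also have "\<dots> = (\<Sum>l\<in>?J. \<alpha> l * (\<Sum>i<d. (x l i - Poly_Mapping.lookup c i)\<^sup>2)) / real m"
    using m by (simp add: power2_eq_square)
  also have "\<dots> \<le> ((1 / real (card P)) * (\<Sum>p\<in>P. (euclid_norm (p - c))\<^sup>2)) / real m"
    by (intro divide_right_mono var) simp
  finally show ?thesis using \<tau> unfolding c_def by blast
qed

theorem lemma5:
  shows "\<exists>C::real. \<forall>d::nat. \<exists>grid :: point list \<Rightarrow> real \<Rightarrow> point set.
    \<forall>(j::nat) (os :: point list) (\<epsilon>::real).
      1 \<le> j \<and> length os = j \<and> set os \<subseteq> Rd d \<and> 0 < \<epsilon> \<and> \<epsilon> \<le> 1 \<longrightarrow>
        finite (grid os \<epsilon>) \<and>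
        grid os \<epsilon> \<subseteq> convex hull (set os) \<and>
        real (card (grid os \<epsilon>)) \<le> C * (8 * real j / \<epsilon>) ^ j \<and>
        (\<forall>(P :: point set) (Pl :: nat \<Rightarrow> point set) (\<delta>::real).
          finite P \<and> P \<subseteq> Rd d \<and>
          P = (\<Union>l<j. Pl l) \<and> (\<forall>l<j. Pl l \<noteq> {}) \<and> disjoint_family_on Pl {..<j} \<and>
          (\<forall>l<j. os ! l = mean_point (Pl l)) \<and>
          0 \<le> \<delta> \<and> \<delta>\<^sup>2 = (1 / real (card P)) * (\<Sum>p\<in>P. (euclid_norm (p - mean_point P))\<^sup>2) \<longrightarrow>
          (\<exists>\<tau>\<in>grid os \<epsilon>. euclid_norm (\<tau> - mean_point P) \<le> sqrt \<epsilon> * \<delta>))"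
\<comment> \<open>The constant is 1 in every dimension, and the sample size is the least integer
  \<open>m\<close> with \<open>1 / m\<close> at most \<epsilon>.\<close>
proof (intro exI[of _ 1] allI exI[of _ "\<lambda>os \<epsilon>. simplex_grid (nat \<lceil>1 / \<epsilon>\<rceil>) os"] impI conjI;
    elim conjE)
  fix d j :: nat and os :: "point list" and \<epsilon> :: real
  assume j: "1 \<le> j" "length os = j" and \<epsilon>: "0 < \<epsilon>" "\<epsilon> \<le> 1"
  let ?m = "nat \<lceil>1 / \<epsilon>\<rceil>"
  have m: "?m > 0" "1 / \<epsilon> \<le> real ?m" "real ?m \<le> 1 / \<epsilon> + 1"
    using \<epsilon> by simp_all
  show "finite (simplex_grid ?m os)"
    by (simp add: simplex_grid_def finite_multiplicities)
  show "simplex_grid ?m os \<subseteq> convex hull (set os)"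
    by (rule simplex_grid_subset_hull[OF m(1)])
  have "card (simplex_grid ?m os) \<le> (?m + 1) ^ j"
    unfolding simplex_grid_def j(2)
    by (rule order_trans[OF card_image_le card_multiplicities_le]) (rule finite_multiplicities)
  then have "real (card (simplex_grid ?m os)) \<le> (real ?m + 1) ^ j"
    by (metis of_nat_le_iff of_nat_power of_nat_add of_nat_1)
  also have "real ?m + 1 \<le> 8 * real j / \<epsilon>"
  proof -
    have "real ?m + 1 \<le> 1 / \<epsilon> + 2" using m(3) by linarith
    \<comment> \<open>Since \<epsilon> \<le> 1, the summand 2 is at most
      \<open>2 / \<epsilon>\<close>.\<close>
    also have "\<dots> \<le> 3 / \<epsilon>" using \<epsilon> by (simp add: field_simps)
    also have "\<dots> \<le> 8 * real j / \<epsilon>" using j \<epsilon> by (intro divide_right_mono) simp_all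
    finally show ?thesis .
  qed
  then have "(real ?m + 1) ^ j \<le> 1 * (8 * real j / \<epsilon>) ^ j"
    by (simp add: power_mono)
  finally show "real (card (simplex_grid ?m os)) \<le> 1 * (8 * real j / \<epsilon>) ^ j" .
  fix P :: "point set" and Pl :: "nat \<Rightarrow> point set" and \<delta> :: real
  assume P: "finite P" "P \<subseteq> Rd d" "P = (\<Union>l<j. Pl l)" "\<forall>l<j. Pl l \<noteq> {}"
    "disjoint_family_on Pl {..<j}" "\<forall>l<j. os ! l = mean_point (Pl l)"
    and \<delta>: "0 \<le> \<delta>" "\<delta>\<^sup>2 = (1 / real (card P)) * (\<Sum>p\<in>P. (euclid_norm (p - mean_point P))\<^sup>2)"
  have "\<exists>\<tau>\<in>simplex_grid ?m os. (euclid_norm (\<tau> - mean_point P))\<^sup>2 \<le> \<delta>\<^sup>2 / real ?m"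
    unfolding \<delta>(2) using P j m(1)
    by (intro simplex_grid_approximates_mean[where d = d and Pl = Pl]) auto
  then obtain \<tau> where \<tau>: "\<tau> \<in> simplex_grid ?m os"
    "(euclid_norm (\<tau> - mean_point P))\<^sup>2 \<le> \<delta>\<^sup>2 / real ?m" by blast
  have "1 / real ?m \<le> \<epsilon>"
    using m \<epsilon> by (metis divide_le_eq mult.commute of_nat_0_less_iff)
  from mult_right_mono[OF this, of "\<delta>\<^sup>2"] have "\<delta>\<^sup>2 / real ?m \<le> \<epsilon> * \<delta>\<^sup>2" by simp
  also have "\<dots> = (sqrt \<epsilon> * \<delta>)\<^sup>2" using \<epsilon> by (simp add: power_mult_distrib)
  finally have "(euclid_norm (\<tau> - mean_point P))\<^sup>2 \<le> (sqrt \<epsilon> * \<delta>)\<^sup>2"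
    by (rule order_trans[OF \<tau>(2)])
  moreover have "0 \<le> sqrt \<epsilon> * \<delta>" using \<delta>(1) \<epsilon> by simp
  ultimately have "euclid_norm (\<tau> - mean_point P) \<le> sqrt \<epsilon> * \<delta>"
    by (rule power2_le_imp_le)
  then show "\<exists>\<tau>\<in>simplex_grid ?m os. euclid_norm (\<tau> - mean_point P) \<le> sqrt \<epsilon> * \<delta>"
    using \<tau>(1) by blast
qed

end
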